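(* Distances can be maintained in $\mathrm{DynFOLL}$ under insertions and deletions of $\mathrm{polylog}(n)$ edges for (a) undirected graphs, and (b) acyclic directed graphs. That is, in both cases there is a $\mathrm{DynFOLL}$ program maintaining the relation containing all triples $(u,v,d)$ such that a shortest path from $u$ to $v$ in the current graph has exactly $d$ edges.
   Context: Dynamic complexity setting. All structures have domain $\{0,\dots,n-1\}$ with linear order; numbers $d<n$ are domain elements. Changes insert or delete a set of at most $(\log n)^c$ edges at once (for an arbitrary fixed constant $c$); in case (b) the graph stays acyclic. A dynamic program stores auxiliary relations over the same domain; for each auxiliary relation and change operation it has an update program which, evaluated on the changed input with the old auxiliary relations, defines the new auxiliary relation. The initial input is empty and initial auxiliary relations are first-order definable from it. The program maintains a query if after every sequence of allowed changes from the empty input a designated auxiliary relation equals the query result on the current input. $\mathrm{DynFOLL}$: update programs are DLOGTIME-uniform polynomial-size circuits of depth $O(\log\log n)$ with NOT gates and unbounded fan-in AND/OR gates, equivalently a first-order formula with $\leq,+,\times$ iterated $O(\log\log n)$ times. *)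

theory Defs
  imports Complex_Main "Graph_Theory.Graph_Theory"
begin

section \<open>First-order formulas over structures with arithmetic\<close>

text \<open>
  \<open>Stage\<close> is the relation that is built up when a formula is iterated.  Variables are named by
  natural numbers.
\<close>

datatype symb = Edge | Aux nat | Stage

datatype fo =
    Leq nat nat
  | Plus nat nat nat
  | Times nat nat nat
  | Atom symb "nat list"
  | Neg fo
  | Conj fo fo
  | Exists nat fo

text \<open>
  The domain is \<open>{0,...,n-1}\<close>.  Addition and multiplication are ternary relations, so
  \<open>Plus x y z\<close> fails whenever the sum lies outside the domain.
\<close>

fun sat :: "nat \<Rightarrow> (symb \<Rightarrow> nat list set) \<Rightarrow> (nat \<Rightarrow> nat) \<Rightarrow> fo \<Rightarrow> bool" where
  "sat n I \<sigma> (Leq x y) \<longleftrightarrow> \<sigma> x \<le> \<sigma> y"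
| "sat n I \<sigma> (Plus x y z) \<longleftrightarrow> \<sigma> x + \<sigma> y = \<sigma> z"
| "sat n I \<sigma> (Times x y z) \<longleftrightarrow> \<sigma> x * \<sigma> y = \<sigma> z"
| "sat n I \<sigma> (Atom r xs) \<longleftrightarrow> map \<sigma> xs \<in> I r"
| "sat n I \<sigma> (Neg \<phi>) \<longleftrightarrow> \<not> sat n I \<sigma> \<phi>"
| "sat n I \<sigma> (Conj \<phi> \<psi>) \<longleftrightarrow> sat n I \<sigma> \<phi> \<and> sat n I \<sigma> \<psi>"
| "sat n I \<sigma> (Exists x \<phi>) \<longleftrightarrow> (\<exists>a<n. sat n I (\<sigma>(x := a)) \<phi>)"

text \<open>
  The \<open>k\<close>-ary relation defined by a formula with free variables \<open>0,...,k-1\<close>.  Any other free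
  variable denotes the (definable) domain element 0; likewise an atom with the wrong number of
  arguments is simply false.  Neither convention adds expressive power.
\<close>

definition defined_rel :: "nat \<Rightarrow> (symb \<Rightarrow> nat list set) \<Rightarrow> nat \<Rightarrow> fo \<Rightarrow> nat list set" where
  "defined_rel n I k \<phi> =
     {xs. length xs = k \<and> set xs \<subseteq> {..<n} \<and>
          sat n I (\<lambda>i. if i < length xs then xs ! i else 0) \<phi>}"

fun interp :: "nat rel \<Rightarrow> nat list set list \<Rightarrow> nat list set \<Rightarrow> symb \<Rightarrow> nat list set" where
  "interp E A S Edge = {[u, v] | u v. (u, v) \<in> E}"
| "interp E A S (Aux i) = (if i < length A then A ! i else {})"
| "interp E A S Stage = S"

section \<open>Update programs: first-order formulas iterated doubly logarithmically often\<close>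

text \<open>
  The number of iterations is \<open>factor * (loglog n + 1)\<close>, the normal form of a bound
  \<open>O(log log n)\<close>: the summand 1 takes care of the small \<open>n\<close>, where \<open>log log n\<close> is at most 0
  or undefined.  It is an explicit function of \<open>n\<close>, rather than an arbitrary function with that
  growth, so that no non-uniform information can be hidden in it.
\<close>

definition loglog :: "nat \<Rightarrow> nat" where
  "loglog n = nat \<lceil>log 2 (log 2 (real n))\<rceil>"

record update_program =
  factor :: nat
  stage_arity :: nat
  step :: fo
  result :: fo

text \<open>
  The formula \<open>step\<close> is applied repeatedly to the stage relation, starting from the empty
  relation and with no monotonicity requirement; \<open>result\<close> reads off the defined relation
  from the last stage.
\<close>

definition last_stage ::
    "nat \<Rightarrow> nat rel \<Rightarrow> nat list set list \<Rightarrow> update_program \<Rightarrow> nat list set" where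
  "last_stage n E A U =
     ((\<lambda>S. defined_rel n (interp E A S) (stage_arity U) (step U))
        ^^ (factor U * (loglog n + 1))) {}"

definition updated_rel ::
    "nat \<Rightarrow> nat rel \<Rightarrow> nat list set list \<Rightarrow> nat \<Rightarrow> update_program \<Rightarrow> nat list set" where
  "updated_rel n E A k U = defined_rel n (interp E A (last_stage n E A U)) k (result U)"

section \<open>Dynamic programs\<close>

datatype change = Ins (edges: "nat rel") | Del (edges: "nat rel")

fun apply_change :: "change \<Rightarrow> nat rel \<Rightarrow> nat rel" where
  "apply_change (Ins S) E = E \<union> S"
| "apply_change (Del S) E = E - S"

record aux_relation =
  arity :: nat
  initial :: fo
  on_ins :: update_program
  on_del :: update_program

record dyn_program =
  aux_relations :: "aux_relation list"
  designated :: nat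

fun on_change :: "change \<Rightarrow> aux_relation \<Rightarrow> update_program" where
  "on_change (Ins S) R = on_ins R"
| "on_change (Del S) R = on_del R"

definition initial_aux :: "dyn_program \<Rightarrow> nat \<Rightarrow> nat list set list" where
  "initial_aux P n =
     map (\<lambda>R. defined_rel n (interp {} [] {}) (arity R) (initial R)) (aux_relations P)"

text \<open>All auxiliary relations are updated simultaneously, from the changed graph \<open>E\<close> and the
  old auxiliary relations \<open>A\<close>.  The changed edges are not given to the update programs.\<close>

definition updated_aux ::
    "dyn_program \<Rightarrow> nat \<Rightarrow> change \<Rightarrow> nat rel \<Rightarrow> nat list set list \<Rightarrow> nat list set list" where
  "updated_aux P n \<delta> E A =
     map (\<lambda>R. updated_rel n E A (arity R) (on_change \<delta> R)) (aux_relations P)"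

text \<open>\<open>allowed n E \<delta>\<close> says which changes \<open>\<delta>\<close> may be applied to the graph \<open>E\<close> on
  \<open>{0,...,n-1}\<close>.\<close>

inductive reachable_state ::
    "(nat \<Rightarrow> nat rel \<Rightarrow> change \<Rightarrow> bool) \<Rightarrow> dyn_program \<Rightarrow> nat \<Rightarrow>
       nat rel \<Rightarrow> nat list set list \<Rightarrow> bool"
  for allowed P n where
  start: "reachable_state allowed P n {} (initial_aux P n)"
| change: "reachable_state allowed P n E A \<Longrightarrow> allowed n E \<delta> \<Longrightarrow> E' = apply_change \<delta> E \<Longrightarrow>
    reachable_state allowed P n E' (updated_aux P n \<delta> E' A)"

definition maintains ::
    "(nat \<Rightarrow> nat rel \<Rightarrow> change \<Rightarrow> bool) \<Rightarrow> dyn_program \<Rightarrow>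
       (nat \<Rightarrow> nat rel \<Rightarrow> nat list set) \<Rightarrow> bool" where
  "maintains allowed P Q \<longleftrightarrow>
     designated P < length (aux_relations P) \<and>
     (\<forall>n>0. \<forall>E A. reachable_state allowed P n E A \<longrightarrow> A ! designated P = Q n E)"

definition maintainable_in_DynFOLL ::
    "(nat \<Rightarrow> nat rel \<Rightarrow> change \<Rightarrow> bool) \<Rightarrow> (nat \<Rightarrow> nat rel \<Rightarrow> nat list set) \<Rightarrow> bool" where
  "maintainable_in_DynFOLL allowed Q \<longleftrightarrow> (\<exists>P. maintains allowed P Q)"

section \<open>Distances and polylogarithmic changes\<close>

abbreviation graph_on :: "nat \<Rightarrow> nat rel \<Rightarrow> (nat, nat \<times> nat) pre_digraph" where
  "graph_on n E \<equiv> with_proj \<lparr>pverts = {..<n}, parcs = E\<rparr>"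

definition path_between :: "nat \<Rightarrow> nat rel \<Rightarrow> nat \<Rightarrow> nat list \<Rightarrow> nat \<Rightarrow> bool" where
  "path_between n E u p v \<longleftrightarrow> vpath p (graph_on n E) \<and> hd p = u \<and> last p = v"

definition shortest_path :: "nat \<Rightarrow> nat rel \<Rightarrow> nat \<Rightarrow> nat list \<Rightarrow> nat \<Rightarrow> bool" where
  "shortest_path n E u p v \<longleftrightarrow>
     path_between n E u p v \<and>
     (\<forall>q. path_between n E u q v \<longrightarrow> vwalk_length p \<le> vwalk_length q)"

definition distances :: "nat \<Rightarrow> nat rel \<Rightarrow> nat list set" where
  "distances n E = {[u, v, d] | u v d. \<exists>p. shortest_path n E u p v \<and> vwalk_length p = d}"

text \<open>
  Undirected graphs are symmetric relations, built up by changes of symmetric sets.  An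
  undirected edge, that is the pair \<open>(u, v)\<close> together with \<open>(v, u)\<close>, counts once.
\<close>

definition undirected_change :: "nat \<Rightarrow> nat \<Rightarrow> nat rel \<Rightarrow> change \<Rightarrow> bool" where
  "undirected_change c n E \<delta> \<longleftrightarrow>
     edges \<delta> \<subseteq> {..<n} \<times> {..<n} \<and> sym (edges \<delta>) \<and>
     real (card ((\<lambda>(u, v). {u, v}) ` edges \<delta>)) \<le> log 2 (real n) ^ c"

definition acyclic_change :: "nat \<Rightarrow> nat \<Rightarrow> nat rel \<Rightarrow> change \<Rightarrow> bool" where
  "acyclic_change c n E \<delta> \<longleftrightarrow>
     edges \<delta> \<subseteq> {..<n} \<times> {..<n} \<and>
     real (card (edges \<delta>)) \<le> log 2 (real n) ^ c \<and>
     acyclic (apply_change \<delta> E)"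

end

theory Submission
  imports Defs
begin

text \<open>
  Call a pair \<open>(x, y)\<close> safe if no deleted edge lies on an old shortest path from \<open>x\<close> to \<open>y\<close>; then
  every old shortest path survives, and the old distance is the length of a walk in the new graph.
  Every new shortest path is a concatenation of polylogarithmically many safe pairs and single
  edges: cut it greedily into minimal pieces with unsafe ends and charge each piece to a changed
  edge, or, in the undirected case of deletions, to a pair of endpoints of deleted edges.
  Disjoint pieces cannot be charged to the same object.  Hence, starting from the safe pairs and the
  edges, \<open>O(log log n)\<close> rounds of composing walks of known lengths produce all distances.
\<close>

section \<open>Distances as powers of the edge relation\<close>

text \<open>Based on walks rather than paths: walks concatenate freely, and the minimal length is
  the same.\<close>

definition is_dist :: "'a rel \<Rightarrow> 'a \<Rightarrow> 'a \<Rightarrow> nat \<Rightarrow> bool" where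
  "is_dist E u v d \<longleftrightarrow> (u, v) \<in> E ^^ d \<and> (\<forall>e<d. (u, v) \<notin> E ^^ e)"

lemma is_dist_exists:
  assumes "(u, v) \<in> E ^^ m"
  obtains d where "d \<le> m" "is_dist E u v d"
proof
  show "(LEAST d. (u, v) \<in> E ^^ d) \<le> m"
    using assms by (rule Least_le)
  show "is_dist E u v (LEAST d. (u, v) \<in> E ^^ d)"
    unfolding is_dist_def using assms by (auto intro: LeastI dest: not_less_Least)
qed

lemma is_dist_le: "is_dist E u v d \<Longrightarrow> (u, v) \<in> E ^^ e \<Longrightarrow> d \<le> e"
  unfolding is_dist_def by (meson not_le)

lemma relpow_comp: "(x, y) \<in> R ^^ s \<Longrightarrow> (y, z) \<in> R ^^ t \<Longrightarrow> (x, z) \<in> R ^^ (s + t)"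
  by (auto simp: relpow_add)

lemma relpow_subset:
  fixes R S :: "'a rel"
  shows "(x, y) \<in> R ^^ k \<Longrightarrow> R \<subseteq> S \<Longrightarrow> (x, y) \<in> S ^^ k"
  by (induction k arbitrary: y) auto

lemma sym_relpow: "sym R \<Longrightarrow> (x, y) \<in> R ^^ k \<Longrightarrow> (y, x) \<in> R ^^ k"
  by (induction k arbitrary: y)
     (auto intro: relpow_Suc_I2 dest: symD simp del: relpow.simps(2) elim!: relpow_Suc_E)

lemma relpow_verts:
  assumes "R \<subseteq> V \<times> V" "(x, y) \<in> R ^^ k" "x \<in> V"
  shows "y \<in> V"
  using assms by (cases k) auto

section \<open>Walks, paths and powers of the edge relation\<close>

lemma vwalk_imp_relpow:
  "vwalk p (graph_on n E) \<Longrightarrow> (hd p, last p) \<in> E ^^ (length p - 1)"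
proof (induction p rule: vwalk_arcs.induct)
  case (3 x y xs)
  then have "(x, y) \<in> E" and "vwalk (y # xs) (graph_on n E)"
    by (auto simp: vwalk_def)
  with 3 have "(y, last (y # xs)) \<in> E ^^ length xs" by simp
  with \<open>(x, y) \<in> E\<close> have "(x, last (y # xs)) \<in> E ^^ Suc (length xs)"
    by (rule relpow_Suc_I2)
  then show ?case by simp
qed (auto simp: vwalk_def)

lemma relpow_imp_vwalk:
  assumes "E \<subseteq> {..<n} \<times> {..<n}"
  shows "(u, v) \<in> E ^^ d \<Longrightarrow> u < n \<Longrightarrow>
    \<exists>p. vwalk p (graph_on n E) \<and> hd p = u \<and> last p = v \<and> length p = Suc d"
proof (induction d arbitrary: u)
  case 0
  then show ?case by (intro exI[of _ "[u]"]) (auto simp: vwalk_def)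
next
  case (Suc d)
  obtain w where "(u, w) \<in> E" "(w, v) \<in> E ^^ d"
    using Suc.prems(1) by (rule relpow_Suc_E2)
  moreover have "w < n" using \<open>(u, w) \<in> E\<close> assms by auto
  ultimately obtain p where "vwalk p (graph_on n E)" "hd p = w" "last p = v" "length p = Suc d"
    using Suc.IH by blast
  then show ?case using \<open>(u, w) \<in> E\<close> \<open>u < n\<close>
    by (intro exI[of _ "u # p"]) (auto simp: vwalk_def)
qed

lemma length_vwalk_to_vpath: "length (vwalk_to_vpath p) \<le> length p"
proof (induction p rule: vwalk_to_vpath.induct)
  case (2 x xs)
  show ?case
  proof (cases "x \<in> set xs")
    case True
    then show ?thesis
      using 2(1)[OF True] length_dropWhile_le[of "\<lambda>y. y \<noteq> x" xs] by simp
  qed (use 2 in simp)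
qed simp

lemma path_between_length:
  assumes "E \<subseteq> {..<n} \<times> {..<n}" "u < n" "(u, v) \<in> E ^^ e"
  shows "\<exists>p. path_between n E u p v \<and> vwalk_length p \<le> e"
proof -
  obtain p where p: "vwalk p (graph_on n E)" "hd p = u" "last p = v" "length p = Suc e"
    using relpow_imp_vwalk[OF assms(1,3,2)] by blast
  have "path_between n E u (vwalk_to_vpath p) v"
    unfolding path_between_def
    using p vwalk_to_vpath_vpath[OF p(1)] by (simp add: vwalk_to_vpath_hd vwalk_to_vpath_last)
  moreover have "length (vwalk_to_vpath p) - 1 \<le> e"
    using length_vwalk_to_vpath[of p] p by simp
  ultimately show ?thesis by auto
qed

lemma path_between_relpow:
  assumes "path_between n E u p v"
  shows "(u, v) \<in> E ^^ vwalk_length p" and "vwalk_length p < n" and "u < n" and "v < n"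
proof -
  have p: "vwalk p (graph_on n E)" "distinct p" "hd p = u" "last p = v"
    using assms by (auto simp: path_between_def vpath_def)
  show "(u, v) \<in> E ^^ vwalk_length p" using vwalk_imp_relpow[OF p(1)] p by simp
  have sub: "set p \<subseteq> {..<n}" "p \<noteq> []" using p(1) by (auto simp: vwalk_def)
  have "length p \<le> n"
    using p(2) sub card_mono[of "{..<n}" "set p"] by (simp add: distinct_card)
  then show "vwalk_length p < n" using sub by (cases p) auto
  show "u < n" "v < n" using p sub hd_in_set[of p] last_in_set[of p] by auto
qed

text \<open>Cutting the cycles out of a walk does not lengthen it, so shortest paths and shortest
  walks have equal length. The bound \<open>u < n\<close> excludes pairs \<open>(u, u)\<close>
  outside the domain, which \<open>E ^^ 0\<close> contains.\<close>

lemma distances_iff: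
  assumes "E \<subseteq> {..<n} \<times> {..<n}"
  shows "[u, v, d] \<in> distances n E \<longleftrightarrow> u < n \<and> is_dist E u v d"
proof
  assume "[u, v, d] \<in> distances n E"
  then obtain p where p: "path_between n E u p v" "vwalk_length p = d"
    and min: "\<And>q. path_between n E u q v \<Longrightarrow> vwalk_length p \<le> vwalk_length q"
    by (auto simp: distances_def shortest_path_def)
  have "(u, v) \<notin> E ^^ e" if "e < d" for e
    using path_between_length[OF assms path_between_relpow(3)[OF p(1)], of v e] min p(2) that
    by (meson le_trans not_le)
  then show "u < n \<and> is_dist E u v d"
    using path_between_relpow[OF p(1)] p(2) by (auto simp: is_dist_def)
next
  assume *: "u < n \<and> is_dist E u v d"
  then obtain p where p: "path_between n E u p v" "vwalk_length p \<le> d"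
    using path_between_length[OF assms, of u v d] by (auto simp: is_dist_def)
  have ge: "d \<le> vwalk_length q" if "path_between n E u q v" for q
    using is_dist_le path_between_relpow(1)[OF that] * by metis
  have "shortest_path n E u p v" "vwalk_length p = d"
    using p ge by (auto simp only: shortest_path_def intro: le_trans antisym)
  then show "[u, v, d] \<in> distances n E"
    unfolding distances_def by blast
qed

text \<open>A path has distinct vertices, so every finite distance is itself a domain element and
  can be stored.\<close>

lemma is_dist_bounds:
  assumes "E \<subseteq> {..<n} \<times> {..<n}" "u < n" "is_dist E u v d"
  shows "v < n" "d < n"
proof -
  have "[u, v, d] \<in> distances n E" using assms distances_iff by blast
  then obtain p where "path_between n E u p v" "vwalk_length p = d"
    by (auto simp: distances_def shortest_path_def)
  then show "v < n" "d < n" using path_between_relpow by blast+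
qed

lemma distances_eq:
  assumes "E \<subseteq> {..<n} \<times> {..<n}"
  shows "distances n E = {[u, v, d] | u v d. u < n \<and> is_dist E u v d}"
proof -
  have "\<exists>u v d. xs = [u, v, d]" if "xs \<in> distances n E" for xs
    using that by (auto simp: distances_def)
  then show ?thesis using distances_iff[OF assms] by blast
qed

section \<open>Decomposing a shortest path into segments\<close>

text \<open>The last disjunct is the crucial one: an old distance may be reused if no deleted edge lies
  on any of the old shortest paths that realise it.\<close>

definition segment :: "'a rel \<Rightarrow> 'a rel \<Rightarrow> 'a \<Rightarrow> 'a \<Rightarrow> nat \<Rightarrow> bool" where
  "segment E E' u v d \<longleftrightarrow> u = v \<and> d = 0 \<or> (u, v) \<in> E' \<and> d = 1 \<or>
     is_dist E u v d \<and>
     (\<forall>a b s r. (a, b) \<in> E - E' \<longrightarrow> is_dist E u a s \<longrightarrow> is_dist E b v r \<longrightarrow> s + 1 + r \<noteq> d)"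

text \<open>Follow the walk up to its first edge outside \<open>E'\<close>.\<close>

lemma relpow_leaves_subset:
  "(u, v) \<in> E ^^ d \<Longrightarrow> (u, v) \<notin> E' ^^ d \<Longrightarrow>
   \<exists>a b s r. (a, b) \<in> E - E' \<and> (u, a) \<in> E ^^ s \<and> (b, v) \<in> E ^^ r \<and> s + 1 + r = d"
proof (induction d arbitrary: u)
  case (Suc d)
  obtain w where w: "(u, w) \<in> E" "(w, v) \<in> E ^^ d"
    using Suc.prems(1) by (rule relpow_Suc_E2)
  show ?case
  proof (cases "(u, w) \<in> E'")
    case True
    then have "(w, v) \<notin> E' ^^ d"
      using Suc.prems(2) by (meson relpow_Suc_I2)
    then obtain a b s r where "(a, b) \<in> E - E'" "(w, a) \<in> E ^^ s" "(b, v) \<in> E ^^ r" "s + 1 + r = d"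
      using Suc.IH[OF w(2)] by blast
    then show ?thesis
      using w(1) by (intro exI[of _ a] exI[of _ b] exI[of _ "Suc s"] exI[of _ r])
        (simp_all only: relpow_Suc_I2, simp_all)
  next
    case False
    then show ?thesis
      using w by (intro exI[of _ u] exI[of _ w] exI[of _ 0] exI[of _ d]) auto
  qed
qed simp

lemma segment_sound:
  assumes "segment E E' u v d"
  shows "(u, v) \<in> E' ^^ d"
proof (rule ccontr)
  assume neg: "(u, v) \<notin> E' ^^ d"
  then have D: "is_dist E u v d"
    and safe: "\<And>a b s r. (a, b) \<in> E - E' \<Longrightarrow> is_dist E u a s \<Longrightarrow> is_dist E b v r \<Longrightarrow> s + 1 + r \<noteq> d"
    using assms by (auto simp: segment_def)
  obtain a b s r where ab: "(a, b) \<in> E - E'" "(u, a) \<in> E ^^ s" "(b, v) \<in> E ^^ r" "s + 1 + r = d"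
    using relpow_leaves_subset[of u v d E E', OF _ neg] D unfolding is_dist_def by blast
  obtain s' where s': "s' \<le> s" "is_dist E u a s'" using is_dist_exists[OF ab(2)] .
  obtain r' where r': "r' \<le> r" "is_dist E b v r'" using is_dist_exists[OF ab(3)] .
  \<comment> \<open>Shortening both parts of the walk cannot beat the distance \<open>d\<close>,
    hence \<open>s' + 1 + r' = d\<close>, which is what safety forbids.\<close>
  have "(u, v) \<in> E ^^ (s' + (1 + r'))"
    using ab(1) s'(2) r'(2)
    by (intro relpow_comp[of u a] relpow_comp[of a b]) (auto simp: is_dist_def)
  then have "d \<le> s' + (1 + r')" using D is_dist_le by metis
  then show False using safe[OF ab(1) s'(2) r'(2)] ab(4) s'(1) r'(1) by simp
qed

text \<open>Either \<open>d\<close> is the old distance and an old shortest path uses a deleted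
  edge, or some old walk is shorter than \<open>d\<close> and cannot have survived, because
  \<open>d\<close> is the new distance.\<close>

lemma not_segment_deleted:
  assumes "E' \<subseteq> E" "is_dist E' u v d" "\<not> segment E E' u v d"
  obtains a b s r where "(a, b) \<in> E - E'" "(u, a) \<in> E ^^ s" "(b, v) \<in> E ^^ r" "s + 1 + r \<le> d"
proof (cases "is_dist E u v d")
  case True
  then obtain a b s r where "(a, b) \<in> E - E'" "is_dist E u a s" "is_dist E b v r" "s + 1 + r = d"
    using assms(3) by (auto simp: segment_def)
  then show ?thesis using that[of a b s r] unfolding is_dist_def by blast
next
  case False
  have "(u, v) \<in> E ^^ d" using assms(1,2) relpow_subset[of u v d E' E] by (auto simp: is_dist_def)
  then obtain e where e: "e < d" "(u, v) \<in> E ^^ e" using False by (auto simp: is_dist_def)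
  then have "(u, v) \<notin> E' ^^ e" using assms(2) by (auto simp: is_dist_def)
  from relpow_leaves_subset[OF e(2) this] obtain a b s r
    where "(a, b) \<in> E - E'" "(u, a) \<in> E ^^ s" "(b, v) \<in> E ^^ r" "s + 1 + r = e" by blast
  then show ?thesis using that[of a b s r] e(1) by simp
qed

section \<open>Greedy cutting\<close>

lemma relpow_pad:
  assumes "(y, y) \<in> R" "(x, y) \<in> R ^^ e" "e \<le> f"
  shows "(x, y) \<in> R ^^ f"
  using assms(3,2,1) by (induction rule: dec_induct) auto

text \<open>Cutting greedily: every cut point ends a minimal piece that is not good, and different such
  pieces have different colours.\<close>

lemma greedy_decomposition:
  fixes good :: "nat \<Rightarrow> nat \<Rightarrow> bool"
  assumes refl: "\<And>i. good i i" and step: "\<And>i. i < m \<Longrightarrow> good i (Suc i)"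
    and G: "G = {(i, j). i \<le> j \<and> j \<le> m \<and> good i j}"
  shows "finite C \<Longrightarrow> i \<le> m \<Longrightarrow>
    (\<And>p q. i \<le> p \<Longrightarrow> p < q \<Longrightarrow> q \<le> m \<Longrightarrow> \<not> good p q \<Longrightarrow> col p q \<in> C) \<Longrightarrow>
    (\<And>p q p' q'. i \<le> p \<Longrightarrow> p < q \<Longrightarrow> q \<le> p' \<Longrightarrow> p' < q' \<Longrightarrow> q' \<le> m \<Longrightarrow>
       \<not> good p q \<Longrightarrow> \<not> good p' q' \<Longrightarrow> col p q \<noteq> col p' q') \<Longrightarrow>
    (i, m) \<in> G ^^ (2 * card C + 1)"
proof (induction "card C" arbitrary: C i)
  case 0
  then have "C = {}" by simp
  then have "good i m"
    using refl[of m] "0.prems"(2) "0.prems"(3)[of i m] by (cases "i = m") auto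
  then have "(i, m) \<in> G" using "0.prems"(2) by (simp add: G)
  then show ?case using \<open>C = {}\<close> by simp
next
  case (Suc k)
  show ?case
  proof (cases "\<exists>j>i. j \<le> m \<and> \<not> good i j")
    case False
    then have "good i m" using refl[of m] \<open>i \<le> m\<close> by (cases "i = m") auto
    then have "(i, m) \<in> G ^^ 1" using \<open>i \<le> m\<close> by (simp add: G)
    moreover have "(m, m) \<in> G" using refl[of m] by (simp add: G)
    moreover have "1 \<le> 2 * card C + 1" by simp
    ultimately show ?thesis by (metis relpow_pad)
  next
    case True
    define j where "j = (LEAST j. i < j \<and> j \<le> m \<and> \<not> good i j)"
    have j: "i < j" "j \<le> m" "\<not> good i j"
      using LeastI_ex[of "\<lambda>j. i < j \<and> j \<le> m \<and> \<not> good i j"] True unfolding j_def by auto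
    \<comment> \<open>The piece before the least bad end \<open>j\<close> is good, and so is the
      single step to \<open>j\<close>: each cut costs two good pieces, hence the factor 2 in the
      exponent.\<close>
    have "good i (j - 1)"
    proof (rule ccontr)
      assume bad: "\<not> good i (j - 1)"
      then have "j - 1 \<noteq> i" using refl by metis
      then have "i < j - 1 \<and> j - 1 \<le> m \<and> \<not> good i (j - 1)" using j bad by auto
      then have "j \<le> j - 1" unfolding j_def by (rule Least_le)
      then show False using j by simp
    qed
    then have "(i, j - 1) \<in> G" "(j - 1, j) \<in> G"
      using j step[of "j - 1"] by (auto simp: G)
    then have two: "(i, j) \<in> G ^^ 2"
      by (simp only: numeral_2_eq_2 relpow.simps(2) relpow.simps(1) Id_O_R relcomp.relcompI)
    have c: "col i j \<in> C" using Suc.prems(3)[of i j] j by simp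
    \<comment> \<open>The colour of the piece from \<open>i\<close> to \<open>j\<close> is spent:
      every bad piece from \<open>j\<close> on has another one.\<close>
    have "(j, m) \<in> G ^^ (2 * card (C - {col i j}) + 1)"
    proof (rule Suc.hyps(1))
      show "k = card (C - {col i j})" using card_Suc_Diff1[OF Suc.prems(1) c] Suc.hyps(2) by simp
      show "col p q \<in> C - {col i j}" if "j \<le> p" "p < q" "q \<le> m" "\<not> good p q" for p q
        using Suc.prems(3)[of p q] Suc.prems(4)[of i j p q] that j by force
      show "col p q \<noteq> col p' q'"
        if "j \<le> p" "p < q" "q \<le> p'" "p' < q'" "q' \<le> m" "\<not> good p q" "\<not> good p' q'" for p q p' q'
        using Suc.prems(4)[of p q p' q'] that j by simp
      show "finite (C - {col i j})" using Suc.prems(1) by simp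
    qed (rule j)
    then have "(i, m) \<in> G ^^ (2 + (2 * card (C - {col i j}) + 1))"
      using relpow_comp[OF two] by blast
    moreover have "2 + (2 * card (C - {col i j}) + 1) = 2 * card C + 1"
      using card_Suc_Diff1[OF Suc.prems(1) c] by simp
    ultimately show ?thesis by (simp only:)
  qed
qed


section \<open>Shortest paths as sequences of positions\<close>

definition geodesic :: "'a rel \<Rightarrow> (nat \<Rightarrow> 'a) \<Rightarrow> nat \<Rightarrow> bool" where
  "geodesic E f m \<longleftrightarrow> (\<forall>i j. i \<le> j \<longrightarrow> j \<le> m \<longrightarrow> is_dist E (f i) (f j) (j - i))"

text \<open>A graph on the positions of the path: an \<open>N\<close>-step walk from 0 to
  \<open>m\<close> in it is a decomposition into \<open>N\<close> segments, possibly of length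
  0.\<close>

definition segment_steps :: "'a rel \<Rightarrow> 'a rel \<Rightarrow> (nat \<Rightarrow> 'a) \<Rightarrow> nat \<Rightarrow> nat rel" where
  "segment_steps E E' f m = {(i, j). i \<le> j \<and> j \<le> m \<and> segment E E' (f i) (f j) (j - i)}"

lemma is_dist_geodesic:
  assumes "is_dist E u v m"
  obtains f where "f 0 = u" "f m = v" "geodesic E f m"
proof -
  obtain f where f: "f 0 = u" "f m = v" "\<And>i. i < m \<Longrightarrow> (f i, f (Suc i)) \<in> E"
    using assms unfolding is_dist_def relpow_fun_conv by blast
  have walk: "(f i, f j) \<in> E ^^ (j - i)" if "i \<le> j" "j \<le> m" for i j
    unfolding relpow_fun_conv using that f(3)
    by (intro exI[of _ "\<lambda>t. f (i + t)"]) auto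
  have "j - i \<le> e" if ij: "i \<le> j" "j \<le> m" and e: "(f i, f j) \<in> E ^^ e" for i j e
  proof -
    \<comment> \<open>A shortcut between two positions would shorten the whole path.\<close>
    have "(u, v) \<in> E ^^ (i + (e + (m - j)))"
      using walk[of 0 i] walk[of j m] e ij f(1,2)
      by (intro relpow_comp[of u "f i"] relpow_comp[of "f i" "f j"]) auto
    then have "m \<le> i + (e + (m - j))" using assms is_dist_le by metis
    then show ?thesis using ij by linarith
  qed
  then have "geodesic E f m" using walk
    unfolding geodesic_def is_dist_def by (meson not_le)
  with f that show ?thesis by blast
qed

lemma geodesic_le: "geodesic E f m \<Longrightarrow> i \<le> j \<Longrightarrow> j \<le> m \<Longrightarrow> (f i, f j) \<in> E ^^ e \<Longrightarrow> j - i \<le> e"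
  unfolding geodesic_def by (meson is_dist_le)

lemma geodesic_walk: "geodesic E f m \<Longrightarrow> i \<le> j \<Longrightarrow> j \<le> m \<Longrightarrow> (f i, f j) \<in> E ^^ (j - i)"
  unfolding geodesic_def is_dist_def by blast

lemma geodesic_inj: "geodesic E f m \<Longrightarrow> i \<le> j \<Longrightarrow> j \<le> m \<Longrightarrow> f i = f j \<Longrightarrow> i = j"
  using geodesic_le[of E f m i j 0] by simp

text \<open>\<open>P p q c\<close> says that the piece from \<open>p\<close> to \<open>q\<close> may
  be charged to \<open>c\<close>. The object charged is not canonical, so a choice turns this
  relation into the colouring that greedy cutting asks for.\<close>

lemma segment_decomposition:
  assumes geo: "geodesic E' f m" and fin: "finite C"
    and colour: "\<And>p q. p < q \<Longrightarrow> q \<le> m \<Longrightarrow> \<not> segment E E' (f p) (f q) (q - p) \<Longrightarrow> \<exists>c\<in>C. P p q c"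
    and disjoint: "\<And>p q p' q' c. p < q \<Longrightarrow> q \<le> p' \<Longrightarrow> p' < q' \<Longrightarrow> q' \<le> m \<Longrightarrow>
      P p q c \<Longrightarrow> P p' q' c \<Longrightarrow> False"
  shows "(0, m) \<in> segment_steps E E' f m ^^ (2 * card C + 1)"
proof (rule greedy_decomposition[where good = "\<lambda>i j. segment E E' (f i) (f j) (j - i)"
      and col = "\<lambda>p q. SOME c. c \<in> C \<and> P p q c" and i = 0])
  have col: "(SOME c. c \<in> C \<and> P p q c) \<in> C \<and> P p q (SOME c. c \<in> C \<and> P p q c)"
    if "p < q" "q \<le> m" "\<not> segment E E' (f p) (f q) (q - p)" for p q
    using colour[OF that] by (intro someI_ex[of "\<lambda>c. c \<in> C \<and> P p q c"]) blast
  show "segment E E' (f i) (f i) (i - i)" for i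
    by (simp add: segment_def)
  show "segment E E' (f i) (f (Suc i)) (Suc i - i)" if "i < m" for i
    using geodesic_walk[OF geo, of i "Suc i"] that by (simp add: segment_def)
  show "(SOME c. c \<in> C \<and> P p q c) \<in> C"
    if "p < q" "q \<le> m" "\<not> segment E E' (f p) (f q) (q - p)" for p q
    using col[OF that] by blast
  show "(SOME c. c \<in> C \<and> P p q c) \<noteq> (SOME c. c \<in> C \<and> P p' q' c)"
    if "p < q" "q \<le> p'" "p' < q'" "q' \<le> m" "\<not> segment E E' (f p) (f q) (q - p)"
      "\<not> segment E E' (f p') (f q') (q' - p')" for p q p' q'
    using col[of p q] col[of p' q'] disjoint[of p q p' q'] that by fastforce
qed (use fin in \<open>auto simp: segment_steps_def\<close>)

text \<open>A piece made of old edges only realises an old distance, as insertions create but never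
  destroy walks. So an unsafe piece uses an inserted edge, and no edge occurs twice on a
  geodesic.\<close>

lemma segment_decomposition_insert:
  assumes "geodesic (E \<union> S) f m" "finite S"
  shows "(0, m) \<in> segment_steps E (E \<union> S) f m ^^ (2 * card S + 1)"
proof (rule segment_decomposition[OF assms,
      where P = "\<lambda>p q c. \<exists>t. p \<le> t \<and> t < q \<and> c = (f t, f (Suc t))"])
  fix p q assume pq: "p < q" "q \<le> m" and bad: "\<not> segment E (E \<union> S) (f p) (f q) (q - p)"
  have D: "is_dist (E \<union> S) (f p) (f q) (q - p)"
    using assms(1) pq by (simp add: geodesic_def)
  have "(f p, f q) \<notin> E ^^ (q - p)"
  proof
    assume "(f p, f q) \<in> E ^^ (q - p)"
    then have "is_dist E (f p) (f q) (q - p)"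
      using D relpow_subset[of "f p" "f q" _ E "E \<union> S"] by (auto simp: is_dist_def)
    then show False using bad by (auto simp: segment_def)
  qed
  then have "\<exists>t<q - p. (f (p + t), f (p + Suc t)) \<notin> E"
    using pq unfolding relpow_fun_conv by (auto dest!: spec[of _ "\<lambda>t. f (p + t)"])
  then obtain t where t: "t < q - p" "(f (p + t), f (p + Suc t)) \<notin> E" by blast
  have "(f (p + t), f (Suc (p + t))) \<in> E \<union> S"
    using geodesic_walk[OF assms(1), of "p + t" "Suc (p + t)"] t pq by simp
  with t pq show "\<exists>c\<in>S. \<exists>t. p \<le> t \<and> t < q \<and> c = (f t, f (Suc t))"
    by (intro bexI[of _ "(f (p + t), f (Suc (p + t)))"] exI[of _ "p + t"]) auto
next
  fix p q p' q' c
  assume "p < q" "q \<le> p'" "p' < q'" "q' \<le> m"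
    and "\<exists>t. p \<le> t \<and> t < q \<and> c = (f t, f (Suc t))"
    and "\<exists>t. p' \<le> t \<and> t < q' \<and> c = (f t, f (Suc t))"
  then obtain t t' where "t < t'" "t' \<le> m" "f t = f t'"
    by (metis Pair_inject less_imp_le order_less_le_trans)
  then show False using geodesic_inj[OF assms(1), of t t'] by simp
qed

text \<open>Two disjoint unsafe pieces with the same deleted edge \<open>(a, b)\<close> would yield a cycle: from \<open>b\<close>
  to the end of the first piece, on to the start of the second one, and from there to \<open>a\<close>.\<close>

lemma segment_decomposition_delete_acyclic:
  assumes "geodesic (E - S) f m" "finite S" "acyclic E"
  shows "(0, m) \<in> segment_steps E (E - S) f m ^^ (2 * card S + 1)"
proof (rule segment_decomposition[OF assms(1,2),
      where P = "\<lambda>p q (a, b). (a, b) \<in> E \<and> (f p, a) \<in> E\<^sup>* \<and> (b, f q) \<in> E\<^sup>*"])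
  fix p q assume pq: "p < q" "q \<le> m" and bad: "\<not> segment E (E - S) (f p) (f q) (q - p)"
  have D: "is_dist (E - S) (f p) (f q) (q - p)"
    using assms(1) pq by (simp add: geodesic_def)
  obtain a b s r where "(a, b) \<in> E - (E - S)" "(f p, a) \<in> E ^^ s" "(b, f q) \<in> E ^^ r"
    using not_segment_deleted[OF Diff_subset D bad] .
  then show "\<exists>c\<in>S. case c of (a, b) \<Rightarrow> (a, b) \<in> E \<and> (f p, a) \<in> E\<^sup>* \<and> (b, f q) \<in> E\<^sup>*"
    by (intro bexI[of _ "(a, b)"]) (simp_all add: relpow_imp_rtrancl)
next
  fix p q p' q' c
  assume pq: "p < q" "q \<le> p'" "p' < q'" "q' \<le> m"
    and "case c of (a, b) \<Rightarrow> (a, b) \<in> E \<and> (f p, a) \<in> E\<^sup>* \<and> (b, f q) \<in> E\<^sup>*"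
    and "case c of (a, b) \<Rightarrow> (a, b) \<in> E \<and> (f p', a) \<in> E\<^sup>* \<and> (b, f q') \<in> E\<^sup>*"
  then obtain a b where ab: "(a, b) \<in> E" "(b, f q) \<in> E\<^sup>*" "(f p', a) \<in> E\<^sup>*"
    by (cases c) auto
  have "(f q, f p') \<in> (E - S)\<^sup>*"
    using geodesic_walk[OF assms(1), of q p'] pq by (simp add: relpow_imp_rtrancl)
  then have "(f q, f p') \<in> E\<^sup>*"
    using rtrancl_mono[of "E - S" E] by blast
  then have "(b, a) \<in> E\<^sup>*"
    using rtrancl_trans[OF rtrancl_trans[OF ab(2)] ab(3)] by blast
  then have "(a, a) \<in> E\<^sup>+" using ab(1) by (simp add: rtrancl_into_trancl2)
  then show False using assms(3) by (simp add: acyclic_def)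
qed

text \<open>Stop the walk at the first edge missing from \<open>E'\<close>, whose tail lies in
  \<open>A\<close>; if none is missing, \<open>a\<close> itself serves.\<close>

lemma first_deleted:
  fixes E E' :: "'a rel"
  shows "(x, a) \<in> E ^^ s \<Longrightarrow> a \<in> A \<Longrightarrow> fst ` (E - E') \<subseteq> A \<Longrightarrow>
    \<exists>a'\<in>A. \<exists>s'\<le>s. (x, a') \<in> E' ^^ s'"
proof (induction s arbitrary: x)
  case (Suc s)
  obtain w where w: "(x, w) \<in> E" "(w, a) \<in> E ^^ s"
    using Suc.prems(1) by (rule relpow_Suc_E2)
  show ?case
  proof (cases "(x, w) \<in> E'")
    case True
    obtain a' s' where "a' \<in> A" "s' \<le> s" "(w, a') \<in> E' ^^ s'"
      using Suc.IH[OF w(2)] Suc.prems by blast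
    with relpow_Suc_I2[OF True] show ?thesis
      by (intro bexI[of _ a'] exI[of _ "Suc s'"]) simp_all
  next
    case False
    then have "(x, w) \<in> E - E'" using w(1) by simp
    then have "x \<in> A" using Suc.prems(3) by (metis fst_conv image_subset_iff)
    then show ?thesis by (intro bexI[of _ x] exI[of _ 0]) simp_all
  qed
qed auto

text \<open>The mirror image of \<open>first_deleted\<close>, by induction from the end of the
  walk.\<close>

lemma last_deleted:
  fixes E E' :: "'a rel"
  shows "(b, y) \<in> E ^^ r \<Longrightarrow> b \<in> B \<Longrightarrow> snd ` (E - E') \<subseteq> B \<Longrightarrow>
    \<exists>b'\<in>B. \<exists>r'\<le>r. (b', y) \<in> E' ^^ r'"
proof (induction r arbitrary: y)
  case (Suc r)
  obtain w where w: "(b, w) \<in> E ^^ r" "(w, y) \<in> E"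
    using Suc.prems(1) by (rule relpow_Suc_E)
  show ?case
  proof (cases "(w, y) \<in> E'")
    case True
    obtain b' r' where "b' \<in> B" "r' \<le> r" "(b', w) \<in> E' ^^ r'"
      using Suc.IH[OF w(1)] Suc.prems by blast
    with relpow_Suc_I[OF _ True] show ?thesis
      by (intro bexI[of _ b'] exI[of _ "Suc r'"]) simp_all
  next
    case False
    then have "(w, y) \<in> E - E'" using w(2) by simp
    then have "y \<in> B" using Suc.prems(3) by (metis snd_conv image_subset_iff)
    then show ?thesis by (intro bexI[of _ y] exI[of _ 0]) simp_all
  qed
qed auto

text \<open>The colour of an unsafe piece from \<open>x\<close> to \<open>y\<close> consists of the first and the last endpoint,
  \<open>a\<close> and \<open>b\<close>, of deleted edges on an old walk from \<open>x\<close> to \<open>y\<close> that is no longer than the piece;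
  the walk survives from \<open>x\<close> to \<open>a\<close> and from \<open>b\<close> to \<open>y\<close>.  If a later piece from \<open>x'\<close> to \<open>y'\<close> had the
  same colour, then the detours from \<open>x\<close> to \<open>x'\<close> via \<open>a\<close> and from \<open>y\<close> to \<open>y'\<close> via \<open>b\<close> would
  together be shorter than the geodesic.\<close>

lemma segment_decomposition_delete_sym:
  assumes "geodesic (E - S) f m" "finite S" "sym (E - S)"
  shows "(0, m) \<in> segment_steps E (E - S) f m ^^ (2 * card (fst ` S \<times> snd ` S) + 1)"
proof (rule segment_decomposition[OF assms(1),
      where P = "\<lambda>p q (a, b). \<exists>s r. (f p, a) \<in> (E - S) ^^ s \<and> (b, f q) \<in> (E - S) ^^ r \<and> s + r < q - p"])
  show "finite (fst ` S \<times> snd ` S)" using assms(2) by simp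
next
  fix p q assume pq: "p < q" "q \<le> m" and bad: "\<not> segment E (E - S) (f p) (f q) (q - p)"
  have D: "is_dist (E - S) (f p) (f q) (q - p)"
    using assms(1) pq by (simp add: geodesic_def)
  obtain a b s r where ab: "(a, b) \<in> E - (E - S)" "(f p, a) \<in> E ^^ s" "(b, f q) \<in> E ^^ r"
      "s + 1 + r \<le> q - p"
    using not_segment_deleted[OF Diff_subset D bad] .
  then have "(a, b) \<in> S" by simp
  then have ends: "a \<in> fst ` S" "b \<in> snd ` S" by force+
  \<comment> \<open>\<open>a'\<close> and \<open>b'\<close> may belong to different deleted edges,
    so the colours are pairs of endpoints and their number is quadratic.\<close>
  obtain a' s' where "a' \<in> fst ` S" "s' \<le> s" "(f p, a') \<in> (E - S) ^^ s'"
    using first_deleted[OF ab(2) ends(1), of "E - S"] by blast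
  moreover obtain b' r' where "b' \<in> snd ` S" "r' \<le> r" "(b', f q) \<in> (E - S) ^^ r'"
    using last_deleted[OF ab(3) ends(2), of "E - S"] by blast
  moreover have "s' + r' < q - p" using calculation ab(4) by linarith
  ultimately show "\<exists>c\<in>fst ` S \<times> snd ` S. case c of (a, b) \<Rightarrow>
      \<exists>s r. (f p, a) \<in> (E - S) ^^ s \<and> (b, f q) \<in> (E - S) ^^ r \<and> s + r < q - p"
    by (intro bexI[of _ "(a', b')"]) auto
next
  fix p q p' q' c
  assume pq: "p < q" "q \<le> p'" "p' < q'" "q' \<le> m"
    and "case c of (a, b) \<Rightarrow>
      \<exists>s r. (f p, a) \<in> (E - S) ^^ s \<and> (b, f q) \<in> (E - S) ^^ r \<and> s + r < q - p"
    and "case c of (a, b) \<Rightarrow>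
      \<exists>s r. (f p', a) \<in> (E - S) ^^ s \<and> (b, f q') \<in> (E - S) ^^ r \<and> s + r < q' - p'"
  then obtain a b s r s' r' where
      sr: "(f p, a) \<in> (E - S) ^^ s" "(b, f q) \<in> (E - S) ^^ r" "s + r < q - p"
    and sr': "(f p', a) \<in> (E - S) ^^ s'" "(b, f q') \<in> (E - S) ^^ r'" "s' + r' < q' - p'"
    by (cases c) auto
  have "(f p, f p') \<in> (E - S) ^^ (s + s')"
    using relpow_comp[OF sr(1) sym_relpow[OF assms(3) sr'(1)]] .
  then have "p' - p \<le> s + s'" using geodesic_le[OF assms(1), of p p'] pq by simp
  moreover have "(f q, f q') \<in> (E - S) ^^ (r + r')"
    using relpow_comp[OF sym_relpow[OF assms(3) sr(2)] sr'(2)] .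
  then have "q' - q \<le> r + r'" using geodesic_le[OF assms(1), of q q'] pq by simp
  \<comment> \<open>Adding up all four inequalities yields \<open>p' < q\<close>.\<close>
  ultimately show False using sr(3) sr'(3) pq by linarith
qed

section \<open>The update program\<close>

text \<open>The semantics of one round. The stage is replaced rather than extended, so the segments
  are supplied again each time.\<close>

definition doubling :: "nat \<Rightarrow> nat rel \<Rightarrow> nat rel \<Rightarrow> nat list set \<Rightarrow> nat list set" where
  "doubling n E E' T = {[u, v, d] | u v d. u < n \<and> v < n \<and> d < n \<and>
     (segment E E' u v d \<or>
      (\<exists>w<n. \<exists>d1<n. \<exists>d2<n. [u, w, d1] \<in> T \<and> [w, v, d2] \<in> T \<and> d1 + d2 = d))}"

lemma doubling_iff:
  "[u, v, d] \<in> doubling n E E' T \<longleftrightarrow> u < n \<and> v < n \<and> d < n \<and>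
     (segment E E' u v d \<or>
      (\<exists>w<n. \<exists>d1<n. \<exists>d2<n. [u, w, d1] \<in> T \<and> [w, v, d2] \<in> T \<and> d1 + d2 = d))"
  unfolding doubling_def by simp

lemma doubling_sound: "[u, v, d] \<in> (doubling n E E' ^^ k) {} \<Longrightarrow> (u, v) \<in> E' ^^ d"
proof (induction k arbitrary: u v d)
  case (Suc k)
  from Suc.prems have "segment E E' u v d \<or>
      (\<exists>w d1 d2. [u, w, d1] \<in> (doubling n E E' ^^ k) {} \<and>
         [w, v, d2] \<in> (doubling n E E' ^^ k) {} \<and> d1 + d2 = d)"
    unfolding funpow.simps comp_apply doubling_iff by blast
  then show ?case
  proof
    assume "segment E E' u v d"
    then show ?thesis by (rule segment_sound)
  next
    assume "\<exists>w d1 d2. [u, w, d1] \<in> (doubling n E E' ^^ k) {} \<and>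
         [w, v, d2] \<in> (doubling n E E' ^^ k) {} \<and> d1 + d2 = d"
    then obtain w d1 d2 where "[u, w, d1] \<in> (doubling n E E' ^^ k) {}"
        "[w, v, d2] \<in> (doubling n E E' ^^ k) {}" "d1 + d2 = d" by blast
    then show ?thesis using relpow_comp[OF Suc.IH Suc.IH] by blast
  qed
qed simp

text \<open>The first round produces single segments and each further one doubles their number,
  hence \<open>Suc k\<close> rounds for \<open>2 ^ k\<close> segments. All lengths involved are at
  most \<open>m\<close> and thus domain elements.\<close>

lemma doubling_complete:
  assumes "\<And>i. i \<le> m \<Longrightarrow> f i < n" "m < n"
  shows "(i, j) \<in> segment_steps E E' f m ^^ (2 ^ k) \<Longrightarrow>
    i \<le> j \<and> j \<le> m \<and> [f i, f j, j - i] \<in> (doubling n E E' ^^ Suc k) {}"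
proof (induction k arbitrary: i j)
  case 0
  then have "i \<le> j" "j \<le> m" "segment E E' (f i) (f j) (j - i)"
    by (auto simp: segment_steps_def)
  moreover have "f i < n" "f j < n" "j - i < n" using calculation assms by auto
  ultimately show ?case by (simp add: doubling_iff)
next
  case (Suc k)
  have "(i, j) \<in> segment_steps E E' f m ^^ (2 ^ k) O segment_steps E E' f m ^^ (2 ^ k)"
    using Suc.prems by (simp only: power_Suc mult_2 relpow_add)
  then obtain h where "(i, h) \<in> segment_steps E E' f m ^^ (2 ^ k)"
      "(h, j) \<in> segment_steps E E' f m ^^ (2 ^ k)"
    by (rule relcompEpair)
  from Suc.IH[OF this(1)] Suc.IH[OF this(2)]
  have h: "i \<le> h" "h \<le> j" "j \<le> m"
      "[f i, f h, h - i] \<in> (doubling n E E' ^^ Suc k) {}"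
      "[f h, f j, j - h] \<in> (doubling n E E' ^^ Suc k) {}"
    by blast+
  have bounds: "f i < n" "f h < n" "f j < n" "h - i < n" "j - h < n" "j - i < n"
    using h(1-3) assms by auto
  have "[f i, f j, j - i] \<in> doubling n E E' ((doubling n E E' ^^ Suc k) {})"
    unfolding doubling_iff using h bounds
    by (intro conjI disjI2 exI[of _ "f h"] exI[of _ "h - i"] exI[of _ "j - h"]) simp_all
  then show ?case using h by simp
qed

section \<open>First-order formulas and the dynamic program\<close>

definition Disj :: "fo \<Rightarrow> fo \<Rightarrow> fo" where
  "Disj \<phi> \<psi> = Neg (Conj (Neg \<phi>) (Neg \<psi>))"

definition zero_fo :: "nat \<Rightarrow> fo" where
  "zero_fo x = Plus x x x"

definition one_fo :: "nat \<Rightarrow> fo" where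
  "one_fo x = Conj (Times x x x) (Neg (zero_fo x))"

lemma sat_Disj [simp]: "sat n I \<sigma> (Disj \<phi> \<psi>) \<longleftrightarrow> sat n I \<sigma> \<phi> \<or> sat n I \<sigma> \<psi>"
  by (simp add: Disj_def)

lemma sat_zero_fo [simp]: "sat n I \<sigma> (zero_fo x) \<longleftrightarrow> \<sigma> x = 0"
  by (simp add: zero_fo_def)

lemma sat_one_fo [simp]: "sat n I \<sigma> (one_fo x) \<longleftrightarrow> \<sigma> x = 1"
  by (auto simp: one_fo_def)

text \<open>\<open>Aux 0\<close> holds the distances and \<open>Aux 1\<close> a copy of the edges, which makes the edges
  deleted by the current change definable.\<close>

definition unsafe_fo :: fo where
  "unsafe_fo = Exists 3 (Exists 4 (Conj (Conj (Atom (Aux 1) [3, 4]) (Neg (Atom Edge [3, 4])))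
     (Exists 5 (Exists 6 (Exists 7 (Exists 8
       (Conj (Conj (Atom (Aux 0) [0, 3, 5]) (Atom (Aux 0) [4, 1, 6]))
         (Conj (one_fo 7) (Conj (Plus 5 7 8) (Plus 8 6 2))))))))))"

text \<open>Variables 0, 1, 2 stand for \<open>u\<close>, \<open>v\<close>, \<open>d\<close>. The
  first three disjuncts express \<open>segment\<close>, with equality written as two inequalities;
  the last one concatenates two known walks.\<close>

definition step_fo :: fo where
  "step_fo =
     Disj (Disj (Disj
       (Conj (Conj (Leq 0 1) (Leq 1 0)) (zero_fo 2))
       (Conj (Atom Edge [0, 1]) (one_fo 2)))
       (Conj (Atom (Aux 0) [0, 1, 2]) (Neg unsafe_fo)))
       (Exists 3 (Exists 4 (Exists 5
         (Conj (Conj (Atom Stage [0, 3, 4]) (Atom Stage [3, 1, 5])) (Plus 4 5 2)))))"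

definition minimal_fo :: fo where
  "minimal_fo = Conj (Atom Stage [0, 1, 2])
     (Neg (Exists 3 (Conj (Atom Stage [0, 1, 3]) (Neg (Leq 2 3)))))"

definition dist_update :: "nat \<Rightarrow> update_program" where
  "dist_update k = \<lparr>factor = k, stage_arity = 3, step = step_fo, result = minimal_fo\<rparr>"

text \<open>With zero rounds the copy is read off the changed graph; at the next change it is the
  old graph.\<close>

definition edge_update :: update_program where
  "edge_update = \<lparr>factor = 0, stage_arity = 0, step = Atom Edge [0, 1], result = Atom Edge [0, 1]\<rparr>"

text \<open>One update program serves insertions and deletions, since \<open>segment\<close>
  compares the old and the new graph in either case.\<close>

definition dist_program :: "nat \<Rightarrow> dyn_program" where
  "dist_program k =
     \<lparr>aux_relations =
        [\<lparr>arity = 3, initial = Conj (Conj (Leq 0 1) (Leq 1 0)) (zero_fo 2),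
          on_ins = dist_update k, on_del = dist_update k\<rparr>,
         \<lparr>arity = 2, initial = Atom Edge [0, 1], on_ins = edge_update, on_del = edge_update\<rparr>],
      designated = 0\<rparr>"

definition edge_lists :: "nat rel \<Rightarrow> nat list set" where
  "edge_lists E = {[u, v] | u v. (u, v) \<in> E}"

section \<open>What the formulas define\<close>

lemma defined_rel_3:
  "defined_rel n I 3 \<phi> = {[u, v, d] | u v d. u < n \<and> v < n \<and> d < n \<and>
     sat n I (\<lambda>i. if i < length [u, v, d] then [u, v, d] ! i else 0) \<phi>}"
proof -
  have "length xs = 3 \<longleftrightarrow> (\<exists>u v d. xs = [u, v, d])" for xs :: "nat list"
    by (auto simp: length_Suc_conv numeral_3_eq_3)
  then show ?thesis unfolding defined_rel_def by auto
qed

lemma defined_rel_edges: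
  assumes "E \<subseteq> {..<n} \<times> {..<n}"
  shows "defined_rel n (interp E A T) 2 (Atom Edge [0, 1]) = edge_lists E"
proof -
  have "length xs = 2 \<longleftrightarrow> (\<exists>u v. xs = [u, v])" for xs :: "nat list"
    by (auto simp: length_Suc_conv numeral_2_eq_2)
  then show ?thesis unfolding defined_rel_def edge_lists_def using assms by auto
qed

lemma defined_rel_step:
  assumes E: "E \<subseteq> {..<n} \<times> {..<n}"
  shows "defined_rel n (interp E' [distances n E, edge_lists E] T) 3 step_fo = doubling n E E' T"
proof -
  have dist: "[u, v, d] \<in> distances n E \<longleftrightarrow> u < n \<and> is_dist E u v d" for u v d
    by (rule distances_iff[OF E])
  have edge: "[a, b] \<in> edge_lists E \<longleftrightarrow> (a, b) \<in> E" for a b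
    by (simp add: edge_lists_def)
  have sat: "sat n (interp E' [distances n E, edge_lists E] T)
        (\<lambda>i. if i < length [u, v, d] then [u, v, d] ! i else 0) step_fo \<longleftrightarrow>
      segment E E' u v d \<or>
      (\<exists>w<n. \<exists>d1<n. \<exists>d2<n. [u, w, d1] \<in> T \<and> [w, v, d2] \<in> T \<and> d1 + d2 = d)"
    (is "?L \<longleftrightarrow> ?R") if "u < n" "v < n" "d < n" for u v d
  proof -
    have "?L \<longleftrightarrow> (u = v \<and> d = 0 \<or> (u, v) \<in> E' \<and> d = 1 \<or>
        is_dist E u v d \<and>
        \<not> (\<exists>a<n. \<exists>b<n. (a, b) \<in> E \<and> (a, b) \<notin> E' \<and>
             (\<exists>s<n. \<exists>r<n. \<exists>o'<n. \<exists>h<n. is_dist E u a s \<and> is_dist E b v r \<and>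
                o' = 1 \<and> s + o' = h \<and> h + r = d))) \<or>
        (\<exists>w<n. \<exists>d1<n. \<exists>d2<n. [u, w, d1] \<in> T \<and> [w, v, d2] \<in> T \<and> d1 + d2 = d)"
      using that by (auto simp: step_fo_def unsafe_fo_def dist edge nth_Cons' simp del: One_nat_def)
    \<comment> \<open>Addition being a relation, the formula needs 1 and \<open>s + 1\<close> as
      domain elements; both are below \<open>n\<close> because
      \<open>s + 1 + r = d < n\<close>.\<close>
    also have "(\<exists>a<n. \<exists>b<n. (a, b) \<in> E \<and> (a, b) \<notin> E' \<and>
             (\<exists>s<n. \<exists>r<n. \<exists>o'<n. \<exists>h<n. is_dist E u a s \<and> is_dist E b v r \<and>
                o' = 1 \<and> s + o' = h \<and> h + r = d)) \<longleftrightarrow>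
        (\<exists>a b s r. (a, b) \<in> E - E' \<and> is_dist E u a s \<and> is_dist E b v r \<and> s + 1 + r = d)"
      (is "?A \<longleftrightarrow> ?B")
    proof
      assume ?B
      then obtain a b s r where *: "(a, b) \<in> E - E'" "is_dist E u a s" "is_dist E b v r"
        "s + 1 + r = d" by blast
      moreover have "a < n" "b < n" using * E by auto
      moreover have "s < n" "r < n" "1 < n" "s + 1 < n" using *(4) \<open>d < n\<close> by auto
      ultimately show ?A by blast
    qed blast
    also have "(\<not> ?B) \<longleftrightarrow> (\<forall>a b s r. (a, b) \<in> E - E' \<longrightarrow> is_dist E u a s \<longrightarrow>
        is_dist E b v r \<longrightarrow> s + 1 + r \<noteq> d)"
      by blast
    finally show ?thesis unfolding segment_def .
  qed
  show ?thesis
    unfolding defined_rel_3 doubling_def by (intro Collect_cong iff_exI conj_cong refl sat)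
qed

lemma defined_rel_minimal:
  "defined_rel n (interp E A T) 3 minimal_fo =
     {[u, v, d] | u v d. u < n \<and> v < n \<and> d < n \<and> [u, v, d] \<in> T \<and>
        (\<forall>e<n. [u, v, e] \<in> T \<longrightarrow> d \<le> e)}"
proof -
  have sat: "sat n (interp E A T) (\<lambda>i. if i < length [u, v, d] then [u, v, d] ! i else 0) minimal_fo
      \<longleftrightarrow> [u, v, d] \<in> T \<and> (\<forall>e<n. [u, v, e] \<in> T \<longrightarrow> d \<le> e)" for u v d
    by (auto simp: minimal_fo_def nth_Cons')
  show ?thesis
    unfolding defined_rel_3 by (intro Collect_cong iff_exI conj_cong refl sat)
qed

text \<open>Reduces one update to a bound on the number of segments. The exponent is one less than
  the number of rounds, because the first round yields single segments.\<close>

lemma updated_rel_dist: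
  assumes E: "E \<subseteq> {..<n} \<times> {..<n}" and E': "E' \<subseteq> {..<n} \<times> {..<n}"
    and decomp: "\<And>f m. geodesic E' f m \<Longrightarrow> \<exists>N. (0, m) \<in> segment_steps E E' f m ^^ N \<and>
      N \<le> 2 ^ (k * (loglog n + 1) - 1)"
    and "k > 0"
  shows "updated_rel n E' [distances n E, edge_lists E] 3 (dist_update k) = distances n E'"
proof -
  define l where "l = k * (loglog n + 1) - 1"
  have l: "k * (loglog n + 1) = Suc l" using \<open>k > 0\<close> by (simp add: l_def)
  define T where "T = (doubling n E E' ^^ Suc l) {}"
  have last: "last_stage n E' [distances n E, edge_lists E] (dist_update k) = T"
    by (simp only: last_stage_def dist_update_def update_program.simps defined_rel_step[OF E] l T_def)
  have sound: "(u, v) \<in> E' ^^ d" if "[u, v, d] \<in> T" for u v d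
    using that unfolding T_def by (rule doubling_sound)
  have complete: "v < n \<and> d < n \<and> [u, v, d] \<in> T" if dist: "is_dist E' u v d" and u: "u < n" for u v d
  proof -
    obtain f where f: "f 0 = u" "f d = v" "geodesic E' f d"
      using is_dist_geodesic[OF dist] .
    have bounds: "v < n" "d < n" using is_dist_bounds[OF E' u dist] .
    have verts: "f i < n" if "i \<le> d" for i
      using geodesic_walk[OF f(3), of 0 i] relpow_verts[OF E', of u "f i" i] that f(1) u
      by simp
    obtain N where N: "(0, d) \<in> segment_steps E E' f d ^^ N" "N \<le> 2 ^ l"
      using decomp[OF f(3)] unfolding l_def by blast
    \<comment> \<open>Empty segments at the end pad the decomposition to exactly
      \<open>2 ^ l\<close> segments.\<close>
    have "(d, d) \<in> segment_steps E E' f d" by (simp add: segment_steps_def segment_def)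
    then have "(0, d) \<in> segment_steps E E' f d ^^ (2 ^ l)" using N by (rule relpow_pad)
    from doubling_complete[OF verts bounds(2) this] show ?thesis
      using f bounds by (simp add: T_def del: funpow.simps)
  qed
  \<comment> \<open>Every length in \<open>T\<close> is that of some walk and the distance is among
    them, so the least length is the distance.\<close>
  have iff: "is_dist E' u v d \<longleftrightarrow> v < n \<and> d < n \<and> [u, v, d] \<in> T \<and> (\<forall>e<n. [u, v, e] \<in> T \<longrightarrow> d \<le> e)"
    if "u < n" for u v d
  proof
    assume dist: "is_dist E' u v d"
    show "v < n \<and> d < n \<and> [u, v, d] \<in> T \<and> (\<forall>e<n. [u, v, e] \<in> T \<longrightarrow> d \<le> e)"
      using complete[OF dist that] is_dist_le[OF dist] sound by blast
  next
    assume *: "v < n \<and> d < n \<and> [u, v, d] \<in> T \<and> (\<forall>e<n. [u, v, e] \<in> T \<longrightarrow> d \<le> e)"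
    then obtain e where e: "e \<le> d" "is_dist E' u v e"
      using is_dist_exists[OF sound, of u v d] by blast
    moreover have "d \<le> e" using * complete[OF e(2) that] by blast
    ultimately show "is_dist E' u v d" by simp
  qed
  have "{[u, v, d] | u v d. u < n \<and> v < n \<and> d < n \<and> [u, v, d] \<in> T \<and>
        (\<forall>e<n. [u, v, e] \<in> T \<longrightarrow> d \<le> e)} = distances n E'"
    unfolding distances_eq[OF E'] by (intro Collect_cong iff_exI conj_cong refl iff[symmetric])
  moreover have "result (dist_update k) = minimal_fo" by (simp add: dist_update_def)
  ultimately show ?thesis by (simp only: updated_rel_def last defined_rel_minimal)
qed

section \<open>Correctness along all sequences of changes\<close>

lemma initial_aux_dist_program:
  "initial_aux (dist_program k) n = [distances n {}, edge_lists {}]"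
proof -
  have "is_dist {} u v d \<longleftrightarrow> u = v \<and> d = 0" for u v :: nat and d
    by (cases d) (auto simp: is_dist_def)
  then have "defined_rel n (interp {} [] {}) 3 (Conj (Conj (Leq 0 1) (Leq 1 0)) (zero_fo 2)) =
      distances n {}"
    unfolding distances_eq[of "{}" n, simplified] defined_rel_3 by auto
  moreover have "defined_rel n (interp {} [] {}) 2 (Atom Edge [0, 1]) = edge_lists {}"
    by (rule defined_rel_edges) simp
  ultimately show ?thesis by (simp add: initial_aux_def dist_program_def)
qed

text \<open>Induction over the reachable states. \<open>invar\<close> carries the property of the
  graph class, symmetry or acyclicity, on which the decomposition after the next change
  relies.\<close>

lemma maintains_dist_program:
  assumes init: "invar {}" and "k > 0"
    and allowed: "\<And>n E \<delta>. n > 0 \<Longrightarrow> E \<subseteq> {..<n} \<times> {..<n} \<Longrightarrow> invar E \<Longrightarrow> allowed n E \<delta> \<Longrightarrow>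
      edges \<delta> \<subseteq> {..<n} \<times> {..<n} \<and> invar (apply_change \<delta> E)"
    and decomp: "\<And>n E \<delta> f m. n > 0 \<Longrightarrow> E \<subseteq> {..<n} \<times> {..<n} \<Longrightarrow> invar E \<Longrightarrow> allowed n E \<delta> \<Longrightarrow>
      geodesic (apply_change \<delta> E) f m \<Longrightarrow>
      \<exists>N. (0, m) \<in> segment_steps E (apply_change \<delta> E) f m ^^ N \<and>
        N \<le> 2 ^ (k * (loglog n + 1) - 1)"
  shows "maintains allowed (dist_program k) distances"
proof -
  have "E \<subseteq> {..<n} \<times> {..<n} \<and> invar E \<and> A = [distances n E, edge_lists E]"
    if "reachable_state allowed (dist_program k) n E A" "n > 0" for n E A
    using that(1)
  proof induction
    case start
    then show ?case using init by (simp add: initial_aux_dist_program)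
  next
    case (change E A \<delta> E')
    then have E: "E \<subseteq> {..<n} \<times> {..<n}" "invar E" and A: "A = [distances n E, edge_lists E]"
      by auto
    have \<delta>: "edges \<delta> \<subseteq> {..<n} \<times> {..<n}" "invar E'"
      using allowed[OF \<open>n > 0\<close> E] change.hyps by auto
    have E': "E' \<subseteq> {..<n} \<times> {..<n}"
      using \<delta>(1) E(1) change.hyps by (cases \<delta>) auto
    have "updated_rel n E' A 3 (dist_update k) = distances n E'"
      unfolding A
      using updated_rel_dist[OF E(1) E' _ \<open>k > 0\<close>] decomp[OF \<open>n > 0\<close> E] change.hyps by blast
    moreover have "updated_rel n E' A 2 edge_update = edge_lists E'"
      using defined_rel_edges[OF E'] by (simp add: updated_rel_def edge_update_def)
    ultimately have "updated_aux (dist_program k) n \<delta> E' A = [distances n E', edge_lists E']"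
      by (cases \<delta>) (simp_all add: updated_aux_def dist_program_def)
    then show ?case using E' \<delta>(2) by simp
  qed
  then show ?thesis unfolding maintains_def by (simp add: dist_program_def) fastforce
qed

section \<open>Counting the segments\<close>

lemma log_le_power_loglog: "log 2 (real n) \<le> 2 ^ loglog n"
proof (cases "log 2 (real n) > 0")
  case True
  have "log 2 (log 2 (real n)) \<le> real (loglog n)"
    unfolding loglog_def by linarith
  then have "log 2 (real n) \<le> 2 powr real (loglog n)"
    using True by (simp add: log_le_iff)
  then show ?thesis by (simp add: powr_realpow)
next
  case False
  then have "log 2 (real n) \<le> 0" by simp
  also have "0 \<le> (2::real) ^ loglog n" by simp
  finally show ?thesis .
qed

text \<open>The source of the bound \<open>O(log log n)\<close>: \<open>c * loglog n\<close>
  doublings reach any number up to the allowed size of a change.\<close>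

lemma polylog_le:
  assumes "real K \<le> log 2 (real n) ^ c" "n > 0"
  shows "K \<le> 2 ^ (c * loglog n)"
proof -
  have "log 2 (real n) ^ c \<le> (2 ^ loglog n) ^ c"
    using assms(2) by (intro power_mono log_le_power_loglog) auto
  also have "\<dots> = real (2 ^ (c * loglog n))" by (simp add: mult.commute[of c] power_mult)
  finally show ?thesis using assms(1) by linarith
qed

text \<open>The square is the worst case, pairs of endpoints in undirected deletions. The count is
  at most \<open>2 ^ (2 * (c * L) + 4)\<close>, and the 5 makes up for the subtracted 1.\<close>

lemma segment_count_le:
  fixes C L :: nat
  assumes "C \<le> (2 * 2 ^ (c * L))\<^sup>2"
  shows "2 * C + 1 \<le> 2 ^ ((2 * c + 5) * (L + 1) - 1)"
proof -
  have "2 * C + 1 \<le> 2 * (2 * 2 ^ (c * L))\<^sup>2 + 1" using assms by simp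
  also have "(2 * 2 ^ (c * L))\<^sup>2 = (4::nat) * 2 ^ (2 * (c * L))"
    by (simp add: power_mult_distrib power_even_eq)
  also have "2 * (4 * 2 ^ (2 * (c * L))) + 1 \<le> (2::nat) ^ (2 * (c * L) + 4)"
  proof -
    have "(1::nat) \<le> 2 ^ (2 * (c * L))" by simp
    then have "2 * (4 * 2 ^ (2 * (c * L))) + 1 \<le> 16 * (2::nat) ^ (2 * (c * L))" by linarith
    then show ?thesis by (simp add: power_add)
  qed
  also have "\<dots> \<le> 2 ^ ((2 * c + 5) * (L + 1) - 1)"
    by (rule power_increasing) (auto simp: algebra_simps)
  finally show ?thesis .
qed

text \<open>On either half, \<open>u \<le> v\<close> or \<open>v \<le> u\<close>, an ordered pair is
  determined by its unordered one.\<close>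

lemma card_sym_le:
  fixes S :: "('a::linorder) rel"
  assumes "finite S"
  shows "card S \<le> 2 * card ((\<lambda>(u, v). {u, v}) ` S)"
proof -
  let ?e = "\<lambda>(u, v). {u, v}"
  let ?A = "{(u, v) \<in> S. u \<le> v}" and ?B = "{(u, v) \<in> S. v \<le> u}"
  have "inj_on ?e ?A" "inj_on ?e ?B" by (auto simp: inj_on_def doubleton_eq_iff intro: antisym)
  then have "card ?A = card (?e ` ?A)" "card ?B = card (?e ` ?B)"
    by (simp_all add: card_image)
  moreover have "card (?e ` ?A) \<le> card (?e ` S)" "card (?e ` ?B) \<le> card (?e ` S)"
    using assms by (auto intro!: card_mono)
  moreover have "S = ?A \<union> ?B" by auto
  then have "card S \<le> card ?A + card ?B" using card_Un_le[of ?A ?B] by argo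
  ultimately show ?thesis by linarith
qed

text \<open>The linear count is weakened to the quadratic one so that insertions and deletions share
  the same number of rounds.\<close>

lemma segment_decomposition_ins:
  assumes "geodesic (E \<union> S) f m" "finite S" "card S \<le> 2 * 2 ^ (c * L)"
  shows "\<exists>N. (0, m) \<in> segment_steps E (E \<union> S) f m ^^ N \<and> N \<le> 2 ^ ((2 * c + 5) * (L + 1) - 1)"
proof -
  have "card S \<le> (2 * 2 ^ (c * L))\<^sup>2"
    using assms(3) by (rule order_trans) (simp add: power2_eq_square)
  then show ?thesis
    using segment_decomposition_insert[OF assms(1,2)] segment_count_le by blast
qed

section \<open>Undirected graphs and acyclic directed graphs\<close>

lemma maintains_undirected: "maintains (undirected_change c) (dist_program (2 * c + 5)) distances"
proof (rule maintains_dist_program[where invar = sym])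
  fix n E \<delta> assume E: "sym E" "undirected_change c n E \<delta>"
  then show "edges \<delta> \<subseteq> {..<n} \<times> {..<n} \<and> sym (apply_change \<delta> E)"
    by (cases \<delta>) (auto simp: undirected_change_def sym_def)
next
  fix n E \<delta> and f :: "nat \<Rightarrow> nat" and m
  assume n: "n > 0" and E: "sym E" "undirected_change c n E \<delta>"
    and geo: "geodesic (apply_change \<delta> E) f m"
  have S: "edges \<delta> \<subseteq> {..<n} \<times> {..<n}" "sym (edges \<delta>)"
      "card ((\<lambda>(u, v). {u, v}) ` edges \<delta>) \<le> 2 ^ (c * loglog n)"
    using E(2) n polylog_le by (auto simp: undirected_change_def)
  have fin: "finite (edges \<delta>)" using S(1) by (rule finite_subset) simp
  \<comment> \<open>An undirected edge counts once but contributes up to two ordered pairs.\<close>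
  have card: "card (edges \<delta>) \<le> 2 * 2 ^ (c * loglog n)"
    using card_sym_le[OF fin] S(3) by linarith
  show "\<exists>N. (0, m) \<in> segment_steps E (apply_change \<delta> E) f m ^^ N \<and>
      N \<le> 2 ^ ((2 * c + 5) * (loglog n + 1) - 1)"
  proof (cases \<delta>)
    case (Ins S)
    then show ?thesis using segment_decomposition_ins geo fin card by simp
  next
    case (Del D)
    have D: "geodesic (E - D) f m" "finite D" using geo fin Del by simp_all
    have "sym (E - D)" using S(2) E(1) Del by (auto simp: sym_def)
    note segment_decomposition_delete_sym[OF D this]
    moreover have "card (fst ` D \<times> snd ` D) \<le> (2 * 2 ^ (c * loglog n))\<^sup>2"
      unfolding card_cartesian_product power2_eq_square
      using fin card Del by (intro mult_mono order_trans[OF card_image_le]) auto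
    note segment_count_le[OF this]
    ultimately show ?thesis unfolding Del apply_change.simps by blast
  qed
qed (auto simp: sym_def)

lemma maintains_acyclic: "maintains (acyclic_change c) (dist_program (2 * c + 5)) distances"
proof (rule maintains_dist_program[where invar = acyclic])
  fix n E \<delta> assume "acyclic_change c n E \<delta>"
  then show "edges \<delta> \<subseteq> {..<n} \<times> {..<n} \<and> acyclic (apply_change \<delta> E)"
    by (simp add: acyclic_change_def)
next
  fix n E \<delta> and f :: "nat \<Rightarrow> nat" and m
  assume n: "n > 0" and E: "acyclic E" "acyclic_change c n E \<delta>"
    and geo: "geodesic (apply_change \<delta> E) f m"
  have S: "edges \<delta> \<subseteq> {..<n} \<times> {..<n}" "card (edges \<delta>) \<le> 2 ^ (c * loglog n)"
    using E(2) n polylog_le by (auto simp: acyclic_change_def)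
  have fin: "finite (edges \<delta>)" using S(1) by (rule finite_subset) simp
  have card: "card (edges \<delta>) \<le> 2 * 2 ^ (c * loglog n)" using S(2) by simp
  show "\<exists>N. (0, m) \<in> segment_steps E (apply_change \<delta> E) f m ^^ N \<and>
      N \<le> 2 ^ ((2 * c + 5) * (loglog n + 1) - 1)"
  proof (cases \<delta>)
    case (Ins S)
    then show ?thesis using segment_decomposition_ins geo fin card by simp
  next
    case (Del D)
    have D: "geodesic (E - D) f m" "finite D" using geo fin Del by simp_all
    have "card D \<le> (2 * 2 ^ (c * loglog n))\<^sup>2"
      using card Del by (intro order_trans[OF card[unfolded Del change.sel]])
        (simp_all add: power2_eq_square)
    note segment_count_le[OF this]
    \<comment> \<open>Acyclicity of the graph before the deletion is what matters, since the cycle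
      in the colouring argument runs through old edges.\<close>
    with segment_decomposition_delete_acyclic[OF D E(1)] show ?thesis
      unfolding Del apply_change.simps by blast
  qed
qed (auto simp: acyclic_def)

theorem theorem6:
  shows "(\<forall>c. maintainable_in_DynFOLL (undirected_change c) distances) \<and>
         (\<forall>c. maintainable_in_DynFOLL (acyclic_change c) distances)"
  unfolding maintainable_in_DynFOLL_def
  using maintains_undirected maintains_acyclic by blast

end
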